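(* Let $\mathcal{H}$ be a pseudohalfplane hypergraph on a finite totally ordered vertex set $V$ such that every triple of hyperedges of $\mathcal{H}$ has a common vertex. Then there exists a set of at most $2$ vertices of $V$ that intersects every hyperedge of $\mathcal{H}$.
   Context: A hypergraph $\mathcal{F}$ on a totally ordered finite vertex set $V$ (a family of subsets of $V$) is ABA-free if there are no two hyperedges $A,B\in\mathcal{F}$ and vertices $x<y<z$ with $x,z\in A\setminus B$ and $y\in B\setminus A$. For a family $\mathcal{F}$ of subsets of $V$ let $\bar{\mathcal{F}}=\{V\setminus F: F\in\mathcal{F}\}$. A hypergraph $\mathcal{H}$ on $V$ is a pseudohalfplane hypergraph if there exists an ABA-free hypergraph $\mathcal{F}$ on $V$ such that $\mathcal{H}\subseteq\mathcal{F}\cup\bar{\mathcal{F}}$. *)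

theory Defs
  imports Main
begin

(* The totally ordered finite vertex set is a finite subset V of a linearly ordered type. *)

definition hypergraph_on :: "'a set \<Rightarrow> 'a set set \<Rightarrow> bool" where
  "hypergraph_on V F \<longleftrightarrow> F \<subseteq> Pow V"

definition ABA_free :: "'a::linorder set set \<Rightarrow> bool" where
  "ABA_free F \<longleftrightarrow>
     \<not> (\<exists>A\<in>F. \<exists>B\<in>F. \<exists>x y z. x < y \<and> y < z \<and> x \<in> A - B \<and> z \<in> A - B \<and> y \<in> B - A)"

definition complement_family :: "'a set \<Rightarrow> 'a set set \<Rightarrow> 'a set set" where
  "complement_family V F = {V - A | A. A \<in> F}"

definition pseudohalfplane_hypergraph :: "'a::linorder set \<Rightarrow> 'a set set \<Rightarrow> bool" where
  "pseudohalfplane_hypergraph V H \<longleftrightarrow>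
     hypergraph_on V H \<and>
     (\<exists>F. hypergraph_on V F \<and> ABA_free F \<and> H \<subseteq> F \<union> complement_family V F)"

end

(* Dualise: a vertex v corresponds to the set M v of hyperedges that miss v, and two vertices
   pierce everything iff their sets are disjoint. Order an ABA-free family by the highest vertex
   in which two members differ, so that for A below B all of A - B precedes all of B - A.
   Placing F-hyperedges on a circle according to this order, and each complement at the antipode
   of its base set, gives a locally transitive tournament ("b lies less than a half-turn after
   a"). The hypothesis on triples says that every M v lies in an open half-circle and that every
   three hyperedges are avoided by some M v, and ABA-freeness says that no two sets alternate
   inside a half-circle. Call a hyperedge unskippable if it lies in each M v that contains
   hyperedges on both sides of it; each inclusion-minimal M v contains an unskippable one.
   Choose M v with the fewest unskippable hyperedges, one of them, c, and the unskippable
   hyperedges a and b outside M v that come first on the two sides of c. A set avoiding a, b and c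
   is then disjoint from M v. *)

theory Submission
  imports Defs
begin

section \<open>Circular tournaments and families of sets lying in half-circles\<close>

text \<open>No circle is constructed: transitivity on every out- and in-neighbourhood replaces
  actual positions on it.\<close>

locale cap_family =
  fixes R :: "'b \<Rightarrow> 'b \<Rightarrow> bool" (infix "\<rightarrow>" 50)
    and \<M> :: "'b set set"
  assumes asym: "a \<rightarrow> b \<Longrightarrow> \<not> b \<rightarrow> a"
    and total: "a \<noteq> b \<Longrightarrow> a \<rightarrow> b \<or> b \<rightarrow> a"
    and out_trans: "p \<rightarrow> a \<Longrightarrow> p \<rightarrow> b \<Longrightarrow> p \<rightarrow> c \<Longrightarrow> a \<rightarrow> b \<Longrightarrow> b \<rightarrow> c \<Longrightarrow> a \<rightarrow> c"
    and in_trans: "a \<rightarrow> p \<Longrightarrow> b \<rightarrow> p \<Longrightarrow> c \<rightarrow> p \<Longrightarrow> a \<rightarrow> b \<Longrightarrow> b \<rightarrow> c \<Longrightarrow> a \<rightarrow> c"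
    and finite_family: "finite \<M>"
    and finite_member: "M \<in> \<M> \<Longrightarrow> finite M"
    and member_trans: "M \<in> \<M> \<Longrightarrow> a \<in> M \<Longrightarrow> b \<in> M \<Longrightarrow> c \<in> M \<Longrightarrow> a \<rightarrow> b \<Longrightarrow> b \<rightarrow> c \<Longrightarrow> a \<rightarrow> c"
    and no_alternation: "M \<in> \<M> \<Longrightarrow> N \<in> \<M> \<Longrightarrow> a \<rightarrow> b \<Longrightarrow> b \<rightarrow> c \<Longrightarrow> a \<rightarrow> c \<Longrightarrow>
      a \<in> M - N \<Longrightarrow> b \<in> N - M \<Longrightarrow> c \<in> M - N \<Longrightarrow> False"
    and triple_avoided: "a \<in> \<Union>\<M> \<Longrightarrow> b \<in> \<Union>\<M> \<Longrightarrow> c \<in> \<Union>\<M> \<Longrightarrow> \<exists>M\<in>\<M>. a \<notin> M \<and> b \<notin> M \<and> c \<notin> M"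
begin

lemma total_mem: "a \<in> S \<Longrightarrow> b \<notin> S \<Longrightarrow> a \<rightarrow> b \<or> b \<rightarrow> a"
  using total by metis

text \<open>Reversing all arrows exchanges \<open>out_trans\<close> and \<open>in_trans\<close> and
  preserves the other axioms, so a lemma proved for one orientation also yields its mirror
  image.\<close>

lemma reverse: "cap_family (\<lambda>a b. b \<rightarrow> a) \<M>"
proof
  show "\<not> a \<rightarrow> b" if "b \<rightarrow> a" for a b using asym that .
  show "b \<rightarrow> a \<or> a \<rightarrow> b" if "a \<noteq> b" for a b using total[OF that] by blast
  show "c \<rightarrow> a" if "a \<rightarrow> p" "b \<rightarrow> p" "c \<rightarrow> p" "b \<rightarrow> a" "c \<rightarrow> b" for p a b c
    using in_trans[OF that(3,2,1,5,4)] .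
  show "c \<rightarrow> a" if "p \<rightarrow> a" "p \<rightarrow> b" "p \<rightarrow> c" "b \<rightarrow> a" "c \<rightarrow> b" for p a b c
    using out_trans[OF that(3,2,1,5,4)] .
  show "finite \<M>" by (fact finite_family)
  show "finite M" if "M \<in> \<M>" for M using finite_member[OF that] .
  show "c \<rightarrow> a" if "M \<in> \<M>" "a \<in> M" "b \<in> M" "c \<in> M" "b \<rightarrow> a" "c \<rightarrow> b" for M a b c
    using member_trans[OF that(1,4,3,2,6,5)] .
  show False if "M \<in> \<M>" "N \<in> \<M>" "b \<rightarrow> a" "c \<rightarrow> b" "c \<rightarrow> a" "a \<in> M - N" "b \<in> N - M" "c \<in> M - N"
    for M N a b c
    using no_alternation[OF that(1,2,4,3,5,8,7,6)] .
  show "\<exists>M\<in>\<M>. a \<notin> M \<and> b \<notin> M \<and> c \<notin> M" if "a \<in> \<Union>\<M>" "b \<in> \<Union>\<M>" "c \<in> \<Union>\<M>" for a b c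
    using triple_avoided[OF that] .
qed

section \<open>Betweenness and skippable elements\<close>

text \<open>Both orientations are allowed, which makes the notion invariant under reversal; the
  arrow joining \<open>a\<close> and \<open>c\<close> excludes directed 3-cycles.\<close>

definition btw :: "'b \<Rightarrow> 'b \<Rightarrow> 'b \<Rightarrow> bool" where
  "btw a b c \<longleftrightarrow> a \<rightarrow> b \<and> b \<rightarrow> c \<and> a \<rightarrow> c \<or> c \<rightarrow> b \<and> b \<rightarrow> a \<and> c \<rightarrow> a"

lemma btw_reverse: "cap_family.btw (\<lambda>a b. b \<rightarrow> a) a b c \<longleftrightarrow> btw a b c"
  unfolding btw_def cap_family.btw_def[OF reverse] by blast

definition skippable :: "'b \<Rightarrow> bool" where
  "skippable e \<longleftrightarrow> (\<exists>z\<in>\<M>. \<exists>l\<in>z. \<exists>r\<in>z. e \<notin> z \<and> btw l e r)"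

lemma skippable_reverse: "cap_family.skippable (\<lambda>a b. b \<rightarrow> a) \<M> e \<longleftrightarrow> skippable e"
  unfolding skippable_def cap_family.skippable_def[OF reverse] btw_reverse ..

text \<open>
  On each \<open>x \<in> \<M>\<close> this is a strict order whose minimal elements are not skipped by any
  member, unless that member is a proper subset of \<open>x\<close>.
\<close>

definition further_out :: "'b set \<Rightarrow> 'b \<Rightarrow> 'b \<Rightarrow> bool" where
  "further_out x f e \<longleftrightarrow> f \<in> x \<and> e \<in> x \<and> (\<exists>B\<in>\<M>. \<exists>b\<in>B - x. f \<in> B \<and> e \<notin> B \<and> btw b e f)"

lemma further_out_reverse: "cap_family.further_out (\<lambda>a b. b \<rightarrow> a) \<M> x f e \<longleftrightarrow> further_out x f e"
  unfolding further_out_def cap_family.further_out_def[OF reverse] btw_reverse ..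

lemma further_outI:
  "\<lbrakk>f \<in> x; e \<in> x; B \<in> \<M>; b \<in> B; b \<notin> x; f \<in> B; e \<notin> B; btw b e f\<rbrakk> \<Longrightarrow> further_out x f e"
  unfolding further_out_def by blast

section \<open>The strict order on a member and its minimal elements\<close>

text \<open>The case \<open>e = g\<close> is impossible; otherwise \<open>B\<close> or
  \<open>B'\<close> is also a witness for \<open>g\<close> and \<open>e\<close>, since failure would
  make two sets alternate.\<close>

lemma further_out_trans_aux:
  assumes x: "x \<in> \<M>" and gf: "further_out x g f" and fe: "further_out x f e" and ef: "e \<rightarrow> f"
  shows "further_out x g e"
proof -
  obtain B b where B: "B \<in> \<M>" "b \<in> B" "b \<notin> x" "f \<in> B" "e \<notin> B" "btw b e f" and xs: "e \<in> x" "f \<in> x"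
    using fe unfolding further_out_def by blast
  obtain B' b' where B': "B' \<in> \<M>" "b' \<in> B'" "b' \<notin> x" "g \<in> B'" "f \<notin> B'" "btw b' f g" and g: "g \<in> x"
    using gf unfolding further_out_def by blast
  have b: "b \<rightarrow> e" "b \<rightarrow> f" using B(6) ef asym unfolding btw_def by blast+
  have xt: "p \<in> x \<Longrightarrow> q \<in> x \<Longrightarrow> s \<in> x \<Longrightarrow> p \<rightarrow> q \<Longrightarrow> q \<rightarrow> s \<Longrightarrow> p \<rightarrow> s" for p q s
    using member_trans[OF x] by blast
  have "f \<noteq> g" using B' by blast
  then consider "f \<rightarrow> g" | "g \<rightarrow> f" using total by blast
  then show ?thesis
  proof cases
    case 1
    then have b': "b' \<rightarrow> f" "b' \<rightarrow> g" using B'(6) asym unfolding btw_def by blast+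
    have eg: "e \<rightarrow> g" using xt xs g ef 1 by blast
    show ?thesis
    proof (cases "e \<in> B'")
      case False
      \<comment> \<open>Otherwise \<open>x\<close> and \<open>B'\<close> would alternate at
        \<open>e\<close>, \<open>b'\<close>, \<open>f\<close>; so \<open>B'\<close> skips
        \<open>e\<close> just as it skips \<open>f\<close>.\<close>
      have "\<not> e \<rightarrow> b'"
        using no_alternation[OF x B'(1), of e b' f] ef b' xs B' False by blast
      then have "b' \<rightarrow> e" using total_mem[OF xs(1) B'(3)] by blast
      then show ?thesis
        using further_outI[OF g xs(1) B'(1,2,3,4) False] eg b' unfolding btw_def by blast
    next
      case True
      \<comment> \<open>Were \<open>g\<close> outside \<open>B\<close>, then \<open>B'\<close> and
        \<open>B\<close> would alternate at \<open>e\<close>, \<open>f\<close>,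
        \<open>g\<close>.\<close>
      have gB: "g \<in> B" using no_alternation[OF B'(1) B(1) ef 1 eg] True B B' by blast
      have "b \<rightarrow> g" using member_trans[OF B(1,2,4) gB b(2) 1] .
      then show ?thesis
        using further_outI[OF g xs(1) B(1,2,3) gB B(5)] eg b unfolding btw_def by blast
    qed
  next
    case 2
    then have b': "f \<rightarrow> b'" "g \<rightarrow> b'" using B'(6) asym unfolding btw_def by blast+
    \<comment> \<open>With \<open>b \<rightarrow> b'\<close>, the sets \<open>B'\<close> and
      \<open>x\<close> would alternate at \<open>b\<close>, \<open>f\<close>, \<open>b'\<close>.
      Each case below refutes a configuration by deriving \<open>b \<rightarrow> b'\<close> from
      transitivity inside \<open>B'\<close>.\<close>
    have bB': "b' \<rightarrow> b" if "b \<in> B'"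
    proof -
      have "\<not> b \<rightarrow> b'"
        using no_alternation[OF B'(1) x b(2) b'(1)] that xs B B' by blast
      moreover have "b \<noteq> b'" using b b' asym by blast
      ultimately show ?thesis using total by blast
    qed
    consider "e = g" | "e \<rightarrow> g" | "g \<rightarrow> e" using total by blast
    then show ?thesis
    proof cases
      case c1: 1
      have "b \<in> B'" using no_alternation[OF B(1) B'(1) b(1) ef b(2)] c1 B B' by blast
      moreover have "b \<rightarrow> b'"
        using member_trans[OF B'(1)] \<open>b \<in> B'\<close> B' b b' c1 by blast
      ultimately show ?thesis using bB' asym by blast
    next
      case c2: 2
      have bg: "b \<rightarrow> g"
        using total_mem[OF g B(3)] in_trans[of e f g b] b ef 2 c2 asym by blast
      have gB: "g \<in> B"
      proof (rule ccontr)
        assume gB: "g \<notin> B"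
        have "b \<in> B'" using no_alternation[OF B(1) B'(1) bg 2 b(2)] gB B B' by blast
        moreover have "b \<rightarrow> b'" using member_trans[OF B'(1)] \<open>b \<in> B'\<close> B' bg b' by blast
        ultimately show False using bB' asym by blast
      qed
      show ?thesis
        using further_outI[OF g xs(1) B(1,2,3) gB B(5)] c2 b bg unfolding btw_def by blast
    next
      case c3: 3
      have eb': "e \<rightarrow> b'" using out_trans[of g e f b'] c3 2 b' ef by blast
      have "e \<notin> B'"
      proof
        assume eB: "e \<in> B'"
        have "b \<in> B'" using no_alternation[OF B(1) B'(1) b(1) ef b(2)] eB B B' by blast
        moreover have "b \<rightarrow> b'" using member_trans[OF B'(1)] \<open>b \<in> B'\<close> B' b eb' eB by blast
        ultimately show False using bB' asym by blast
      qed
      then show ?thesis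
        using further_outI[OF g xs(1) B'(1,2,3,4)] c3 b' eb' unfolding btw_def by blast
    qed
  qed
qed

lemma further_out_trans:
  assumes "x \<in> \<M>" "further_out x g f" "further_out x f e"
  shows "further_out x g e"
proof -
  have "e \<noteq> f" using assms(3) unfolding further_out_def by blast
  then consider "e \<rightarrow> f" | "f \<rightarrow> e" using total by blast
  then show ?thesis
    using further_out_trans_aux[OF assms] cap_family.further_out_trans_aux[OF reverse, unfolded further_out_reverse, OF assms]
    by cases blast+
qed

text \<open>The witness is \<open>z\<close> with its point \<open>b\<close>; only
  \<open>b \<rightarrow> r\<close> needs an argument, as \<open>r \<rightarrow> b\<close> would
  order \<open>e\<close> before \<open>b\<close> in the out-neighbourhood of
  \<open>l\<close>.\<close>

lemma minimal_meets_hull_aux: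
  assumes x: "x \<in> \<M>" and z: "z \<in> \<M>" "b \<in> z" "b \<notin> x" and e: "e \<in> x" "e \<notin> z"
    and lr: "l \<in> z" "r \<in> z" "l \<in> x" "r \<in> x" "l \<rightarrow> e" "e \<rightarrow> r" "l \<rightarrow> r" and be: "b \<rightarrow> e"
  shows "further_out x r e"
proof -
  have "\<not> r \<rightarrow> b"
  proof
    assume rb: "r \<rightarrow> b"
    then have "l \<rightarrow> b" using member_trans[OF z(1)] lr z by blast
    then show False using out_trans[of l e r b] lr rb be asym by blast
  qed
  then have "b \<rightarrow> r" using total_mem[OF lr(4) z(3)] by blast
  then show ?thesis
    using further_outI[OF lr(4) e(1) z lr(2) e(2)] be lr unfolding btw_def by blast
qed

text \<open>Take \<open>e\<close> minimal for \<open>further_out x\<close>. If \<open>z\<close>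
  skipped \<open>e\<close>, minimality of \<open>x\<close> would supply a point of \<open>z\<close>
  outside \<open>x\<close>, and \<open>z\<close> would witness that something is further out than
  \<open>e\<close>.\<close>

lemma minimal_meets_hull:
  assumes x: "x \<in> \<M>" "x \<noteq> {}" and min: "\<And>z. z \<in> \<M> \<Longrightarrow> \<not> z \<subset> x"
  shows "\<exists>e\<in>x. \<not> skippable e"
proof -
  have "\<exists>e\<in>x. \<forall>f\<in>x. f \<noteq> e \<longrightarrow> \<not> further_out x f e"
  proof (rule Finite_Set.bex_min_element[OF finite_member[OF x(1)] _ _ x(2)])
    show "transp_on x (further_out x)"
      using further_out_trans[OF x(1)] by (intro transp_onI)
    show "asymp_on x (further_out x)"
      using further_out_trans[OF x(1)] by (intro asymp_onI) (metis further_out_def)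
  qed
  then obtain e where e: "e \<in> x" and e_min': "\<And>f. f \<in> x \<Longrightarrow> f \<noteq> e \<Longrightarrow> \<not> further_out x f e"
    by blast
  have e_min: "\<not> further_out x f e" for f
    using e_min'[of f] unfolding further_out_def by metis
  have False if sk: "skippable e"
  proof -
    obtain z l r where z: "z \<in> \<M>" "e \<notin> z" and lr: "l \<in> z" "r \<in> z" and ler: "l \<rightarrow> e" "e \<rightarrow> r" "l \<rightarrow> r"
      using sk unfolding skippable_def btw_def by blast
    obtain b where b: "b \<in> z" "b \<notin> x" using min[OF z(1)] e z(2) by blast
    \<comment> \<open>If just one of \<open>l\<close>, \<open>r\<close> lay in \<open>x\<close>, the
      other would serve as the point of \<open>z\<close> outside \<open>x\<close>.\<close>
    have l: "l \<in> x" if "r \<in> x"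
      using further_outI[OF that e z(1) lr(1) _ lr(2) z(2)] ler e_min unfolding btw_def by blast
    have r: "r \<in> x" if "l \<in> x"
      using further_outI[OF that e z(1) lr(2) _ lr(1) z(2)] ler e_min unfolding btw_def by blast
    \<comment> \<open>With both outside, \<open>z\<close> and \<open>x\<close> would alternate at
      \<open>l\<close>, \<open>e\<close>, \<open>r\<close>.\<close>
    have lrx: "l \<in> x" "r \<in> x"
      using no_alternation[OF z(1) x(1) ler] lr z(2) e l r by blast+
    consider "b \<rightarrow> e" | "e \<rightarrow> b" using total_mem[OF b(1) z(2)] by blast
    then show False
      using minimal_meets_hull_aux[OF x(1) z(1) b e z(2) lr lrx ler]
        cap_family.minimal_meets_hull_aux[OF reverse x(1) z(1) b e z(2) lr(2,1) lrx(2,1) ler(2,1,3), unfolded further_out_reverse]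
        e_min by cases blast+
  qed
  then show ?thesis using e by blast
qed

section \<open>The hull and the gaps around one of its elements\<close>

text \<open>The restriction to \<open>\<Union>\<M>\<close> keeps the set finite and makes
  \<open>triple_avoided\<close> applicable to its elements.\<close>

definition hull :: "'b set" where
  "hull = {e \<in> \<Union>\<M>. \<not> skippable e}"

lemma hull_reverse: "cap_family.hull (\<lambda>a b. b \<rightarrow> a) \<M> = hull"
  unfolding hull_def cap_family.hull_def[OF reverse] skippable_reverse ..

lemma finite_hull: "finite hull"
  unfolding hull_def using finite_family finite_member by auto

lemma meets_hull:
  assumes "{} \<notin> \<M>" "x \<in> \<M>"
  shows "x \<inter> hull \<noteq> {}"
proof -
  obtain y where y: "y \<in> \<M>" "y \<subseteq> x" "\<And>z. z \<in> \<M> \<Longrightarrow> z \<subseteq> y \<Longrightarrow> y = z"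
    using finite_has_minimal2[OF finite_family assms(2)] by blast
  have "\<exists>e\<in>y. \<not> skippable e" using minimal_meets_hull[of y] y assms(1) by blast
  then show ?thesis using y unfolding hull_def by blast
qed

text \<open>With \<open>l \<rightarrow> r\<close> the set \<open>z\<close> would skip
  \<open>k\<close>. Hence a hull element outside \<open>z\<close> forms a directed 3-cycle with
  elements of \<open>z\<close> on its two sides.\<close>

lemma not_skipped:
  assumes "k \<in> hull" "z \<in> \<M>" "k \<notin> z" "l \<in> z" "r \<in> z" "l \<rightarrow> k" "k \<rightarrow> r"
  shows "r \<rightarrow> l"
proof -
  have "skippable k" if "l \<rightarrow> r"
    unfolding skippable_def btw_def using assms(2-7) that by (intro bexI[of _ z] bexI[of _ l] bexI[of _ r]) auto
  then have "\<not> l \<rightarrow> r" using assms(1) unfolding hull_def by blast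
  moreover have "l \<noteq> r" using assms(6,7) asym by metis
  ultimately show ?thesis using total by metis
qed

text \<open>
  Here \<open>a\<close> is the first element of \<open>D\<close> met when walking backwards from \<open>c\<close>
  around the circle; the second case passes the antipode of \<open>c\<close>.
\<close>

definition pred_gap :: "'b set \<Rightarrow> 'b \<Rightarrow> 'b \<Rightarrow> bool" where
  "pred_gap D c a \<longleftrightarrow> a \<in> D \<and>
     (if \<exists>g\<in>D. g \<rightarrow> c then a \<rightarrow> c \<and> (\<forall>g\<in>D. g \<rightarrow> c \<longrightarrow> \<not> a \<rightarrow> g)
      else \<forall>g\<in>D. \<not> a \<rightarrow> g)"

text \<open>The candidates all lie on one side of \<open>c\<close>, where local transitivity makes
  \<open>\<rightarrow>\<close> a strict order; a maximal one is taken.\<close>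

lemma pred_gap_exists:
  assumes "finite D" "D \<noteq> {}" "c \<notin> D"
  shows "\<exists>a. pred_gap D c a"
proof -
  define D' where "D' = (if \<exists>g\<in>D. g \<rightarrow> c then {g\<in>D. g \<rightarrow> c} else D)"
  have fin: "finite D'" "D' \<noteq> {}" using assms unfolding D'_def by auto
  have D': "(\<forall>g\<in>D'. g \<rightarrow> c) \<or> (\<forall>g\<in>D'. c \<rightarrow> g)"
  proof (cases "\<exists>g\<in>D. g \<rightarrow> c")
    case True
    then show ?thesis unfolding D'_def by simp
  next
    case False
    then show ?thesis using total_mem[OF _ assms(3)] unfolding D'_def by auto
  qed
  have "\<exists>m\<in>D'. \<forall>g\<in>D'. g \<noteq> m \<longrightarrow> \<not> m \<rightarrow> g"
  proof (rule Finite_Set.bex_max_element[OF fin(1) _ _ fin(2)])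
    show "transp_on D' (\<rightarrow>)"
      using D'
    proof
      assume "\<forall>g\<in>D'. g \<rightarrow> c"
      then show ?thesis using in_trans[of _ c] by (intro transp_onI) blast
    next
      assume "\<forall>g\<in>D'. c \<rightarrow> g"
      then show ?thesis using out_trans[of c] by (intro transp_onI) blast
    qed
    show "asymp_on D' (\<rightarrow>)"
      using asym by (intro asymp_onI)
  qed
  then obtain m where "m \<in> D'" "\<And>g. g \<in> D' \<Longrightarrow> \<not> m \<rightarrow> g" using asym by metis
  then show ?thesis unfolding pred_gap_def D'_def by (auto split: if_splits)
qed

section \<open>A pair of disjoint members\<close>

text \<open>Applying \<open>not_skipped\<close> to \<open>a\<close>, \<open>b\<close>,
  \<open>c\<close> fixes the arrows to \<open>f\<close> and \<open>g\<close> until local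
  transitivity fails. The case \<open>c \<rightarrow> g\<close> is the mirror image.\<close>

lemma disjoint_aux:
  assumes x: "x \<in> \<M>" and y: "y \<in> \<M>" and c: "c \<in> x" "c \<in> hull" "c \<notin> y"
    and a: "pred_gap (hull - x) c a" "a \<notin> y"
    and b: "cap_family.pred_gap (\<lambda>a b. b \<rightarrow> a) (hull - x) c b" "b \<notin> y"
    and g: "g \<in> y" "g \<in> hull - x" "g \<rightarrow> c" and f: "f \<in> x" "f \<in> y"
  shows False
proof -
  have a': "a \<in> hull" "a \<notin> x" "a \<rightarrow> c" "\<not> a \<rightarrow> g"
    using a g unfolding pred_gap_def by (auto split: if_splits)
  then have ga: "g \<rightarrow> a" using total_mem[OF g(1) a(2)] by blast
  have b': "b \<in> hull" "b \<notin> x"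
    using b unfolding cap_family.pred_gap_def[OF reverse] by auto
  \<comment> \<open>If \<open>c\<close> has no out-neighbour in \<open>hull - x\<close>, then
    \<open>b\<close> is the first element past the antipode of \<open>c\<close>, with arrows to both
    \<open>c\<close> and \<open>g\<close>.\<close>
  have b'': "c \<rightarrow> b \<or> b \<rightarrow> c \<and> b \<rightarrow> g"
  proof (cases "\<exists>g\<in>hull - x. c \<rightarrow> g")
    case True
    then show ?thesis using b unfolding cap_family.pred_gap_def[OF reverse] by auto
  next
    case False
    then have "\<not> c \<rightarrow> b" "\<not> g \<rightarrow> b"
      using b g unfolding cap_family.pred_gap_def[OF reverse] by auto
    then show ?thesis using total_mem[OF c(1) b'(2)] total_mem[OF g(1) b(2)] by blast
  qed
  have "f \<noteq> c" using f c by blast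
  then consider "f \<rightarrow> c" | "c \<rightarrow> f" using total by blast
  then show False
  proof cases
    case 1
    \<comment> \<open>Since \<open>x\<close> cannot skip \<open>a\<close>,
      \<open>a \<rightarrow> f\<close>. Since \<open>y\<close> cannot either,
      \<open>f \<rightarrow> g\<close>, although \<open>g \<rightarrow> a \<rightarrow> f\<close> is
      transitive below \<open>c\<close>.\<close>
    have "\<not> f \<rightarrow> a" using not_skipped[OF a'(1) x a'(2) f(1) c(1) _ a'(3)] 1 asym by blast
    then have af: "a \<rightarrow> f" using total_mem[OF f(1) a'(2)] by blast
    have "f \<rightarrow> g" using not_skipped[OF a'(1) y a(2) g(1) f(2) ga af] .
    then show False using in_trans[of g c a f] g ga a' af 1 asym by blast
  next
    case 2
    \<comment> \<open>This closes the 3-cycle \<open>c\<close>, \<open>f\<close>, \<open>g\<close>,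
      which will be found inside the in- or out-neighbourhood of \<open>b\<close>, where cycles are
      impossible.\<close>
    have fg: "f \<rightarrow> g" using not_skipped[OF c(2) y c(3) g(1) f(2) g(3) 2] .
    have bf: "f \<rightarrow> b \<or> b \<rightarrow> f" using total_mem[OF f(1) b'(2)] .
    from b'' show False
    proof
      assume cb: "c \<rightarrow> b"
      have fb: "f \<rightarrow> b" using bf not_skipped[OF b'(1) x b'(2) c(1) f(1) cb] 2 asym by blast
      have "\<not> b \<rightarrow> g" using not_skipped[OF b'(1) y b(2) f(2) g(1) fb] fg asym by blast
      then have "g \<rightarrow> b" using total_mem[OF g(1) b(2)] by blast
      then show False using in_trans[of c b f g] cb fb 2 fg g asym by blast
    next
      assume bc: "b \<rightarrow> c \<and> b \<rightarrow> g"
      have "\<not> f \<rightarrow> b" using not_skipped[OF b'(1) y b(2) f(2) g(1)] bc fg asym by blast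
      then have "b \<rightarrow> f" using bf by blast
      then show False using out_trans[of b c f g] bc 2 fg g asym by blast
    qed
  qed
qed

theorem disjoint_members:
  assumes "\<M> \<noteq> {}"
  shows "\<exists>M\<in>\<M>. \<exists>N\<in>\<M>. M \<inter> N = {}"
proof (cases "{} \<in> \<M>")
  case True
  then show ?thesis by blast
next
  case False
  obtain x where x: "x \<in> \<M>" and x_min: "\<And>y. y \<in> \<M> \<Longrightarrow> card (x \<inter> hull) \<le> card (y \<inter> hull)"
    using ex_has_least_nat[of "\<lambda>x. x \<in> \<M>" _ "\<lambda>x. card (x \<inter> hull)"] assms by blast
  obtain c where c: "c \<in> x" "c \<in> hull" using meets_hull[OF False x] by blast
  \<comment> \<open>Otherwise \<open>y\<close>, lacking \<open>c\<close>, would contain fewer hull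
    elements than \<open>x\<close>.\<close>
  have out: "y \<inter> (hull - x) \<noteq> {}" if y: "y \<in> \<M>" "c \<notin> y" for y
  proof
    assume "y \<inter> (hull - x) = {}"
    then have "y \<inter> hull \<subset> x \<inter> hull" using c y(2) by blast
    then have "card (y \<inter> hull) < card (x \<inter> hull)"
      using finite_hull by (simp add: psubset_card_mono)
    then show False using x_min[OF y(1)] by simp
  qed
  have cU: "c \<in> \<Union>\<M>" using c x by blast
  have ne: "hull - x \<noteq> {}" using triple_avoided[OF cU cU cU] out by blast
  obtain a where a: "pred_gap (hull - x) c a"
    using pred_gap_exists[of "hull - x" c] finite_hull ne c by blast
  obtain b where b: "cap_family.pred_gap (\<lambda>a b. b \<rightarrow> a) (hull - x) c b"
    using cap_family.pred_gap_exists[OF reverse, of "hull - x" c] finite_hull ne c by blast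
  have "a \<in> hull" "b \<in> hull"
    using a b unfolding pred_gap_def cap_family.pred_gap_def[OF reverse] by auto
  then obtain y where y: "y \<in> \<M>" "a \<notin> y" "b \<notin> y" "c \<notin> y"
    using triple_avoided[of a b c] cU unfolding hull_def by blast
  obtain g where g: "g \<in> y" "g \<in> hull - x" using out[OF y(1,4)] by blast
  have "x \<inter> y = {}"
  proof (rule ccontr)
    assume "x \<inter> y \<noteq> {}"
    then obtain f where f: "f \<in> x" "f \<in> y" by blast
    consider "g \<rightarrow> c" | "c \<rightarrow> g" using total_mem[OF g(1) y(4)] by blast
    then show False
    proof cases
      case 1
      then show ?thesis using disjoint_aux[OF x y(1) c y(4) a y(2) b y(3) g _ f] by blast
    next
      case 2
      \<comment> \<open>Reversing twice restores the arrows, so in the mirror image \<open>a\<close>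
        takes the role of \<open>b\<close>.\<close>
      have rr: "cap_family.pred_gap (\<lambda>a b. a \<rightarrow> b) (hull - x) c a" using a .
      show ?thesis
        using cap_family.disjoint_aux[OF reverse x y(1) c(1) _ y(4), unfolded hull_reverse, OF c(2) b y(3) rr y(2) g 2 f] .
    qed
  qed
  then show ?thesis using x y(1) by blast
qed

end

section \<open>Linear order of an ABA-free family\<close>

text \<open>\<open>r\<close> reads a set as a binary number, the bit position of a vertex being its
  rank in \<open>V\<close>. All bits below that of \<open>m\<close> together weigh less than the bit
  of \<open>m\<close>.\<close>

lemma binary_weight_less:
  fixes V :: "'a::linorder set"
  defines "r \<equiv> \<lambda>A. \<Sum>v\<in>A. (2::nat) ^ card {w \<in> V. w < v}"
  assumes V: "finite V" and A: "A \<subseteq> V" and B: "B \<subseteq> V"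
    and m: "m \<in> B - A" and above: "\<And>k. m < k \<Longrightarrow> k \<in> A \<longleftrightarrow> k \<in> B"
  shows "r A < r B"
proof -
  let ?i = "\<lambda>v. card {w \<in> V. w < v}"
  have mono: "?i v < ?i w" if "v \<in> V" "v < w" for v w
    using that V by (intro psubset_card_mono) auto
  have inj: "inj_on ?i V"
  proof (intro inj_onI)
    fix v w assume "v \<in> V" "w \<in> V" "?i v = ?i w"
    then show "v = w" using mono[of v w] mono[of w v] by (cases v w rule: linorder_cases) auto
  qed
  have fin: "finite A" "finite B" using A B V finite_subset by blast+
  define C where "C = {v \<in> A. m < v}"
  define D where "D = {v \<in> A. v < m}"
  have AU: "A = C \<union> D" "C \<inter> D = {}" "C \<subseteq> B" "m \<notin> C" "finite C" "finite D" "D \<subseteq> V"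
  proof -
    have "v < m" if "v \<in> A" "\<not> m < v" for v using that m by (cases v m rule: linorder_cases) auto
    then show "A = C \<union> D" unfolding C_def D_def by blast
    show "C \<inter> D = {}" unfolding C_def D_def by auto
    show "C \<subseteq> B" unfolding C_def using above by blast
    show "m \<notin> C" "D \<subseteq> V" unfolding C_def D_def using A by auto
    show "finite C" "finite D" unfolding C_def D_def using fin(1) by simp_all
  qed
  have two: "(\<Sum>j<n. (2::nat) ^ j) < 2 ^ n" for n by (induction n) auto
  have "(\<Sum>v\<in>D. (2::nat) ^ ?i v) = (\<Sum>j\<in>?i ` D. 2 ^ j)"
    using inj AU(7) by (subst sum.reindex) (auto intro: inj_on_subset)
  also have "\<dots> \<le> (\<Sum>j<?i m. 2 ^ j)"
    using mono AU(7) unfolding D_def by (intro sum_mono2) auto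
  also have "\<dots> < 2 ^ ?i m" by (rule two)
  finally have D: "(\<Sum>v\<in>D. (2::nat) ^ ?i v) < 2 ^ ?i m" .
  have "r A = (\<Sum>v\<in>C. 2 ^ ?i v) + (\<Sum>v\<in>D. 2 ^ ?i v)"
    unfolding r_def AU(1) using AU by (intro sum.union_disjoint) auto
  also have "\<dots> < (\<Sum>v\<in>C. 2 ^ ?i v) + 2 ^ ?i m" using D by simp
  also have "\<dots> = (\<Sum>v\<in>insert m C. 2 ^ ?i v)" using AU by simp
  also have "\<dots> \<le> r B" unfolding r_def using fin m AU by (intro sum_mono2) auto
  finally show ?thesis .
qed

text \<open>If the highest difference \<open>m\<close> lies in \<open>B - A\<close>, then
  \<open>q < p\<close> would give \<open>q < p < m\<close>, a forbidden pattern for the pair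
  \<open>B\<close>, \<open>A\<close>.\<close>

lemma ABA_free_order:
  fixes V :: "'a::linorder set"
  assumes V: "finite V" and F: "hypergraph_on V F" "ABA_free F"
  obtains r :: "'a set \<Rightarrow> nat" where "inj_on r (Pow V)"
    and "\<And>A B p q. \<lbrakk>A \<in> F; B \<in> F; r A < r B; p \<in> A - B; q \<in> B - A\<rbrakk> \<Longrightarrow> p < q"
proof
  define r where "r = (\<lambda>A. \<Sum>v\<in>A. (2::nat) ^ card {w \<in> V. w < v})"
  have top: "\<exists>m. (m \<in> B - A \<and> r A < r B \<or> m \<in> A - B \<and> r B < r A) \<and> (\<forall>k. m < k \<longrightarrow> (k \<in> A \<longleftrightarrow> k \<in> B))"
    if AB: "A \<subseteq> V" "B \<subseteq> V" "A \<noteq> B" for A B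
  proof -
    define D where "D = (A - B) \<union> (B - A)"
    have "finite A" "finite B" using AB V finite_subset by blast+
    then have D: "finite D" "D \<noteq> {}" using AB(3) unfolding D_def by auto
    have m: "Max D \<in> D" using Max_in[OF D] .
    have ab: "k \<in> A \<longleftrightarrow> k \<in> B" if "Max D < k" for k
    proof -
      have "k \<notin> D" using Max_ge[OF D(1)] that not_less by blast
      then show ?thesis unfolding D_def by blast
    qed
    have "r A < r B" if "Max D \<in> B - A"
      unfolding r_def using binary_weight_less[OF V AB(1,2) that ab] .
    moreover have "r B < r A" if "Max D \<in> A - B"
      unfolding r_def using binary_weight_less[OF V AB(2,1) that ab[symmetric]] .
    moreover have "Max D \<in> A - B \<or> Max D \<in> B - A" using m unfolding D_def by blast
    ultimately show ?thesis using ab by (intro exI[of _ "Max D"]) blast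
  qed
  show "inj_on r (Pow V)"
  proof (intro inj_onI, rule ccontr)
    fix A B assume "A \<in> Pow V" "B \<in> Pow V" "r A = r B" "A \<noteq> B"
    then show False using top[of A B] by auto
  qed
  show "p < q" if AB: "A \<in> F" "B \<in> F" "r A < r B" and p: "p \<in> A - B" and q: "q \<in> B - A" for A B p q
  proof (rule ccontr)
    assume "\<not> p < q"
    moreover have "p \<noteq> q" using p q by blast
    ultimately have qp: "q < p" by simp
    have "A \<subseteq> V" "B \<subseteq> V" "A \<noteq> B" using AB F(1) unfolding hypergraph_on_def by auto
    then obtain m where m: "m \<in> B - A" and above: "\<forall>k. m < k \<longrightarrow> (k \<in> A \<longleftrightarrow> k \<in> B)"
      using top[of A B] AB(3) by auto
    have "\<not> m < p" "p \<noteq> m" using above p m by blast+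
    then have "p < m" by simp
    then show False using F(2) AB(1,2) p q m qp unfolding ABA_free_def by blast
  qed
qed

section \<open>Pseudohalfplane hypergraphs as circular tournaments\<close>

theorem mainTheorem4:
  fixes V :: "'a::linorder set" and H :: "'a set set"
  assumes "finite V"
    and "pseudohalfplane_hypergraph V H"
    and "\<And>A B C. A \<in> H \<Longrightarrow> B \<in> H \<Longrightarrow> C \<in> H \<Longrightarrow> A \<inter> B \<inter> C \<noteq> {}"
  shows "\<exists>S. S \<subseteq> V \<and> card S \<le> 2 \<and> (\<forall>A\<in>H. A \<inter> S \<noteq> {})"
proof -
  obtain F where F: "hypergraph_on V F" "ABA_free F" and HF: "H \<subseteq> F \<union> complement_family V F"
    and HV: "H \<subseteq> Pow V"
    using assms(2) unfolding pseudohalfplane_hypergraph_def hypergraph_on_def by blast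
  obtain r :: "'a set \<Rightarrow> nat" where r_inj: "inj_on r (Pow V)"
    and r: "\<And>A B p q. \<lbrakk>A \<in> F; B \<in> F; r A < r B; p \<in> A - B; q \<in> B - A\<rbrakk> \<Longrightarrow> p < q"
    by (rule ABA_free_order[OF assms(1) F]) (erule that, blast)
  \<comment> \<open>This undoes complementation; a hyperedge counts as uncomplemented if it and its
    complement both lie in \<open>F\<close>.\<close>
  define base where "base h = {v \<in> V. v \<in> h \<longleftrightarrow> h \<in> F}" for h
  have base_F: "base h \<in> F" if h: "h \<in> H" for h
  proof (cases "h \<in> F")
    case True
    then have "base h = h" using h HV unfolding base_def by blast
    then show ?thesis using True by simp
  next
    case False
    then obtain A where A: "A \<in> F" "h = V - A" using h HF unfolding complement_family_def by blast
    then have "base h = A" using False F(1) unfolding base_def hypergraph_on_def by blast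
    then show ?thesis using A by simp
  qed
  have base_inj: "h = k" if hk: "h \<in> H" "k \<in> H" "base h = base k" for h k
  proof -
    \<comment> \<open>Distinct hyperedges with equal bases would be complementary, but any two
      hyperedges meet.\<close>
    obtain v where v: "v \<in> h" "v \<in> k" using assms(3)[OF hk(1,1,2)] by blast
    then have "v \<in> V" using hk(1) HV by blast
    then have "h \<in> F \<longleftrightarrow> k \<in> F" using hk(3) v unfolding base_def by blast
    then have "w \<in> h \<longleftrightarrow> w \<in> k" if "w \<in> V" for w using hk(3) that unfolding base_def by blast
    then show ?thesis using hk(1,2) HV by blast
  qed
  define idx where "idx h = r (base h)" for h
  have idx_inj: "h = k" if "h \<in> H" "k \<in> H" "idx h = idx k" for h k
    using base_inj[OF that(1,2)] inj_onD[OF r_inj] that(3) unfolding idx_def base_def by blast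
  have before: "p < q"
    if "h \<in> H" "k \<in> H" "idx h < idx k" "p \<in> V" "q \<in> V"
      "p \<in> h \<longleftrightarrow> h \<in> F" "p \<notin> k \<longleftrightarrow> k \<in> F" "q \<in> k \<longleftrightarrow> k \<in> F" "q \<notin> h \<longleftrightarrow> h \<in> F" for h k p q
    using r[OF base_F base_F, of h k p q] that unfolding idx_def base_def by blast
  define col where "col n \<longleftrightarrow> (\<exists>h\<in>H \<inter> F. idx h = n)" for n
  have col: "col (idx h) \<longleftrightarrow> h \<in> F" if "h \<in> H" for h
    using that idx_inj unfolding col_def by blast
  \<comment> \<open>Unequal colours reverse the numerical order: this is the move to the antipode.
    Numbers that index no hyperedge have \<open>col\<close> false, so \<open>R\<close> is a
    tournament on all of \<open>nat\<close>.\<close>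
  define R where "R a b \<longleftrightarrow> a \<noteq> b \<and> (a < b \<longleftrightarrow> (col a \<longleftrightarrow> col b))" for a b
  define M where "M v = idx ` {h \<in> H. v \<notin> h}" for v
  have M_iff: "idx h \<in> M v \<longleftrightarrow> v \<notin> h" if "h \<in> H" for h v
    using that idx_inj unfolding M_def by blast
  have idx_ex: "\<exists>h\<in>H. a = idx h" if "a \<in> M v" for a v using that unfolding M_def by blast
  have R_idx: "R (idx h) (idx k) \<longleftrightarrow> h \<noteq> k \<and> (idx h < idx k \<longleftrightarrow> (h \<in> F \<longleftrightarrow> k \<in> F))"
    if "h \<in> H" "k \<in> H" for h k
    using that col idx_inj unfolding R_def by blast
  have cap: "cap_family R (M ` V)"
  proof
    show "\<not> R b a" if "R a b" for a b using that unfolding R_def by auto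
    show R_total: "R a b \<or> R b a" if "a \<noteq> b" for a b using that unfolding R_def by auto
    show "R a c" if "R p a" "R p b" "R p c" "R a b" "R b c" for p a b c
      using that unfolding R_def by auto
    show "R a c" if "R a p" "R b p" "R c p" "R a b" "R b c" for p a b c
      using that unfolding R_def by auto
    show "finite (M ` V)" using assms(1) by simp
    have "finite H" using assms(1) HV by (meson finite_Pow_iff finite_subset)
    then show "finite X" if "X \<in> M ` V" for X using that unfolding M_def by auto
    show "R a c" if X: "X \<in> M ` V" "a \<in> X" "b \<in> X" "c \<in> X" and ab: "R a b" and bc: "R b c" for X a b c
    proof -
      obtain v where v: "v \<in> V" "X = M v" using X(1) by blast
      obtain A B C where ABC: "A \<in> H" "B \<in> H" "C \<in> H" "a = idx A" "b = idx B" "c = idx C"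
        using idx_ex X v by metis
      have vn: "v \<notin> A" "v \<notin> B" "v \<notin> C" using X M_iff v ABC by auto
      obtain w where w: "w \<in> A" "w \<in> B" "w \<in> C" using assms(3)[OF ABC(1,2,3)] by blast
      have wV: "w \<in> V" using w ABC HV by blast
      \<comment> \<open>Two hyperedges of a 3-cycle share a colour. The third then has the other
        colour and an index between theirs, and \<open>before\<close> on the two gaps orders
        \<open>v\<close> and \<open>w\<close> both ways.\<close>
      have no_cycle: False
        if hkl: "h \<in> {A, B, C}" "k \<in> {A, B, C}" "l \<in> {A, B, C}"
          and cyc: "R (idx h) (idx k)" "R (idx k) (idx l)" "R (idx l) (idx h)" and same: "h \<in> F \<longleftrightarrow> k \<in> F"
        for h k l
      proof -
        have H: "h \<in> H" "k \<in> H" "l \<in> H" and vw: "v \<notin> h" "v \<notin> k" "v \<notin> l" "w \<in> h" "w \<in> k" "w \<in> l"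
          using hkl ABC vn w by auto
        have hk: "idx h < idx k" using cyc(1) same R_idx[OF H(1,2)] by blast
        have k: "k \<noteq> l" "idx k < idx l \<longleftrightarrow> (k \<in> F \<longleftrightarrow> l \<in> F)" using cyc(2) R_idx[OF H(2,3)] by blast+
        have l: "l \<noteq> h" "idx l < idx h \<longleftrightarrow> (l \<in> F \<longleftrightarrow> h \<in> F)" using cyc(3) R_idx[OF H(3,1)] by blast+
        have diff: "l \<in> F \<longleftrightarrow> k \<notin> F" using k l same hk by auto
        have "idx l \<noteq> idx k" "idx h \<noteq> idx l" using idx_inj H k(1) l(1) by blast+
        then have hl: "idx h < idx l" "idx l < idx k" using k(2) l(2) diff same by auto
        show False
        proof (cases "h \<in> F")
          case True
          then have "w < v" "v < w"
            using before[OF H(1,3) hl(1) wV v(1)] before[OF H(3,2) hl(2) v(1) wV] diff same vw by blast+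
          then show False by simp
        next
          case False
          then have "v < w" "w < v"
            using before[OF H(1,3) hl(1) v(1) wV] before[OF H(3,2) hl(2) wV v(1)] diff same vw by blast+
          then show False by simp
        qed
      qed
      have "a \<noteq> c" using ab bc unfolding R_def by auto
      moreover have False if ca: "R c a"
      proof -
        consider "A \<in> F \<longleftrightarrow> B \<in> F" | "B \<in> F \<longleftrightarrow> C \<in> F" | "C \<in> F \<longleftrightarrow> A \<in> F" by blast
        then show False
          using no_cycle[of A B C] no_cycle[of B C A] no_cycle[of C A B] ab bc ca unfolding ABC by cases auto
      qed
      ultimately show "R a c" using R_total by blast
    qed
    show False if X: "X \<in> M ` V" "Y \<in> M ` V" and R: "R a b" "R b c" "R a c"
      and abc: "a \<in> X - Y" "b \<in> Y - X" "c \<in> X - Y" for X Y a b c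
    proof -
      obtain u v where uv: "u \<in> V" "v \<in> V" "X = M u" "Y = M v" using X by blast
      obtain A B C where ABC: "A \<in> H" "B \<in> H" "C \<in> H" "a = idx A" "b = idx B" "c = idx C"
        using idx_ex abc uv by (metis DiffD1)
      have mem: "u \<notin> A" "v \<in> A" "u \<in> B" "v \<notin> B" "u \<notin> C" "v \<in> C"
        using abc M_iff uv ABC by auto
      \<comment> \<open>Equal colours of \<open>A\<close>, \<open>B\<close> or of \<open>B\<close>,
        \<open>C\<close>, and unequal colours of \<open>A\<close>, \<open>C\<close>, each decide how
        \<open>u\<close> and \<open>v\<close> compare. Every colour pattern gives two opposite
        answers, except \<open>B\<close> against \<open>A\<close> and \<open>C\<close>, where the
        indices themselves conflict.\<close>
      have 1: "A \<in> F \<Longrightarrow> B \<in> F \<Longrightarrow> v < u" "A \<notin> F \<Longrightarrow> B \<notin> F \<Longrightarrow> u < v"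
        using before[OF ABC(1,2)] R(1) mem uv unfolding ABC R_idx[OF ABC(1,2)] by blast+
      have 2: "B \<in> F \<Longrightarrow> C \<in> F \<Longrightarrow> u < v" "B \<notin> F \<Longrightarrow> C \<notin> F \<Longrightarrow> v < u"
        using before[OF ABC(2,3)] R(2) mem uv unfolding ABC R_idx[OF ABC(2,3)] by blast+
      have ca: "idx C < idx A" if "A \<in> F \<longleftrightarrow> C \<notin> F"
        using R(3) that idx_inj[OF ABC(1,3)] unfolding ABC R_idx[OF ABC(1,3)]
        by (metis linorder_neqE)
      have 3: "A \<in> F \<Longrightarrow> C \<notin> F \<Longrightarrow> u < v" "A \<notin> F \<Longrightarrow> C \<in> F \<Longrightarrow> v < u"
        using before[OF ABC(3,1)] ca mem uv by blast+
      have 4: False if "A \<in> F \<longleftrightarrow> B \<notin> F" "B \<in> F \<longleftrightarrow> C \<notin> F"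
        using R that ABC unfolding R_def by (auto simp: col)
      show False using 1 2 3 4 less_asym by metis
    qed
    show "\<exists>X\<in>M ` V. a \<notin> X \<and> b \<notin> X \<and> c \<notin> X"
      if abc: "a \<in> \<Union>(M ` V)" "b \<in> \<Union>(M ` V)" "c \<in> \<Union>(M ` V)" for a b c
    proof -
      obtain A B C where ABC: "A \<in> H" "B \<in> H" "C \<in> H" "a = idx A" "b = idx B" "c = idx C"
        using idx_ex abc by (metis UN_E)
      obtain v where v: "v \<in> A" "v \<in> B" "v \<in> C" using assms(3)[OF ABC(1,2,3)] by blast
      then have "v \<in> V" using ABC HV by blast
      then show ?thesis using v M_iff ABC by auto
    qed
  qed
  show ?thesis
  proof (cases "V = {}")
    case True
    then have "H = {}" using HV assms(3) by blast
    then show ?thesis by (intro exI[of _ "{}"]) simp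
  next
    case False
    then obtain u v where uv: "u \<in> V" "v \<in> V" "M u \<inter> M v = {}"
      using cap_family.disjoint_members[OF cap] by blast
    then have "A \<inter> {u, v} \<noteq> {}" if "A \<in> H" for A using M_iff[OF that] by blast
    moreover have "card {u, v} \<le> 2" by (simp add: card_insert_if)
    ultimately show ?thesis using uv(1,2) by (intro exI[of _ "{u, v}"]) simp
  qed
qed

end
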